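(* Let $n\ge3$. Let $K:[-1,1]\to[0,\infty)$ be bounded, Borel, and nondecreasing, and define $$(\mathcal Kf)(z)=\int_{\mathbb S^{n-1}}K(z\cdot\omega)f(\omega)\,d\mu(\omega).$$ Let $\kappa_1$ be its degree-one spherical-harmonic multiplier, equivalently the number with $$\int_{\mathbb S^{n-1}}K(z\cdot\omega)\,\omega\,d\mu(\omega)=\kappa_1z\qquad(z\in\mathbb S^{n-1}).$$ Let $\gamma$ be a Borel probability measure on $\mathbb S^{n-1}_x\times\mathbb S^{n-1}_\omega$ whose first marginal (in the variable $x$) is $\mu$, and define the $\mathbb R^n$-valued vector measure $$\mathcal N_\gamma(E)=\int_{\mathbb S^{n-1}\times E}x\,d\gamma(x,\omega)$$ for Borel $E\subset\mathbb S^{n-1}$, with the action of $\mathcal K$ given by $$(\mathcal K\mathcal N_\gamma)(z)=\int_{\mathbb S^{n-1}}K(z\cdot\omega)\,d\mathcal N_\gamma(\omega)=\int_{\mathbb S^{n-1}\times\mathbb S^{n-1}}K(z\cdot\omega)\,x\,d\gamma(x,\omega).$$ Then $$\|\mathcal K\mathcal N_\gamma\|_{L^1(\mu)}\le\kappa_1,$$ where $\|F\|_{L^1(\mu)}=\int_{\mathbb S^{n-1}}|F|\,d\mu$ with the Euclidean norm. The constant $\kappa_1$ is sharp: for each such $K$ there is a probability measure $\gamma$ with first marginal $\mu$ for which equality holds.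
   Context: $\mathbb S^{n-1}$ is the unit sphere of $\mathbb R^n$ and $\mu$ is the normalized surface measure (a probability measure) on $\mathbb S^{n-1}$. The second marginal of $\gamma$ is arbitrary and may be singular with respect to $\mu$. *)

theory Defs
  imports "HOL-Analysis.Analysis" "HOL-Probability.Probability"
begin

abbreviation unit_sphere :: "(real ^ 'n) set"
  where "unit_sphere \<equiv> sphere 0 1"

text \<open>
  The Borel sets of the unit sphere carry the normalized surface measure given by polar coordinates:
  the mass of \<open>A\<close> is the relative volume in the unit ball of the cone over \<open>A\<close>
  (lemma \<open>emeasure_sphere_measure\<close>).  Here \<open>sgn x = x /\<^sub>R norm x\<close>; the origin, where
  \<open>sgn\<close> leaves the sphere, is a null set.
\<close>

definition sphere_measure :: "(real ^ 'n) measure"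
  where "sphere_measure =
    restrict_space (distr (uniform_measure lborel (ball 0 1)) borel sgn) unit_sphere"

lemma space_sphere_measure: "space (sphere_measure :: (real ^ 'n) measure) = unit_sphere"
  by (simp add: sphere_measure_def space_restrict_space)

lemma sets_sphere_measure:
  "sets (sphere_measure :: (real ^ 'n) measure) = sets (restrict_space borel unit_sphere)"
  unfolding sphere_measure_def by (intro sets_restrict_space_cong) simp

lemma emeasure_sphere_measure:
  fixes A :: "(real ^ 'n) set"
  assumes "A \<in> sets (restrict_space borel unit_sphere)"
  shows "emeasure sphere_measure A =
    emeasure lborel {x \<in> ball 0 1. sgn x \<in> A} / emeasure lborel (ball 0 1 :: (real ^ 'n) set)"
proof -
  have S: "(unit_sphere :: (real ^ 'n) set) \<in> sets borel" by simp
  have A: "A \<in> sets borel" "A \<subseteq> unit_sphere"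
    using assms S by (auto simp: sets_restrict_space_iff)
  have m: "(sgn :: real ^ 'n \<Rightarrow> _) \<in> borel_measurable borel"
    unfolding sgn_div_norm by measurable
  have "sgn -` A \<in> sets (borel :: (real ^ 'n) measure)"
    using measurable_sets[OF m A(1)] by simp
  moreover have "ball 0 1 \<inter> sgn -` A = {x \<in> ball 0 1. sgn x \<in> A}" by auto
  ultimately show ?thesis
    using A S m
    by (simp add: sphere_measure_def emeasure_restrict_space emeasure_distr)
qed

lemma prob_space_sphere_measure: "prob_space (sphere_measure :: (real ^ 'n) measure)"
proof
  let ?B = "ball 0 1 :: (real ^ 'n) set"
  have fin: "emeasure lborel ?B \<noteq> \<infinity>" using emeasure_lborel_ball_finite[of "0 :: real ^ 'n" 1] by auto
  have pos: "emeasure lborel ?B \<noteq> 0"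
    using content_ball_pos[of 1 "0 :: real ^ 'n"] by (auto simp: measure_def)
  have eq: "{x \<in> ?B. sgn x \<in> unit_sphere} = ?B - {0}" by (auto simp: norm_sgn)
  have "emeasure lborel (?B - {0}) = emeasure lborel ?B"
    by (intro emeasure_Diff_null_set) auto
  moreover have "(unit_sphere :: (real ^ 'n) set) \<in> sets (restrict_space borel unit_sphere)"
    by (simp add: sets_restrict_space_iff)
  ultimately show "emeasure sphere_measure (space (sphere_measure :: (real ^ 'n) measure)) = 1"
    using fin pos
    by (subst space_sphere_measure, subst emeasure_sphere_measure)
      (simp_all only: eq, simp add: ennreal_divide_self top.not_eq_extremum)
qed

definition sphere_op :: "(real \<Rightarrow> real) \<Rightarrow> (real ^ 'n \<Rightarrow> real) \<Rightarrow> real ^ 'n \<Rightarrow> real"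
  where "sphere_op K f z = (\<integral>\<omega>. K (z \<bullet> \<omega>) * f \<omega> \<partial>sphere_measure)"

text \<open>
  The spherical harmonics of degree one are the restrictions to the sphere of the linear forms.
  The type argument records the dimension.
\<close>

definition degree_one_multiplier :: "'n::finite itself \<Rightarrow> (real \<Rightarrow> real) \<Rightarrow> real"
  where "degree_one_multiplier _ K =
    (THE \<kappa>. \<forall>Y :: real ^ 'n \<Rightarrow> real. linear Y \<longrightarrow>
      (\<forall>z\<in>unit_sphere. sphere_op K Y z = \<kappa> * Y z))"

definition sphere_coupling :: "((real ^ 'n) \<times> (real ^ 'n)) measure \<Rightarrow> bool"
  where "sphere_coupling \<gamma> \<longleftrightarrow>
    sets \<gamma> = sets (restrict_space borel (unit_sphere \<times> unit_sphere)) \<and>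
    prob_space \<gamma> \<and>
    distr \<gamma> (restrict_space borel unit_sphere) fst = sphere_measure"

definition coupling_vector_measure ::
    "((real ^ 'n) \<times> (real ^ 'n)) measure \<Rightarrow> (real ^ 'n) set \<Rightarrow> real ^ 'n"
  where "coupling_vector_measure \<gamma> E = (LINT (x, \<omega>) : unit_sphere \<times> E | \<gamma>. x)"

text \<open>
  Integration of a bounded measurable scalar function against a vector-valued set function \<open>\<nu>\<close>
  on the measurable sets of \<open>M\<close> (only the space and the measurable sets of \<open>M\<close> are used):
  the common limit of the integrals of all sequences of simple functions converging uniformly to
  the integrand.
\<close>

definition simple_vector_integral ::
    "'a measure \<Rightarrow> ('a set \<Rightarrow> 'b::real_normed_vector) \<Rightarrow> ('a \<Rightarrow> real) \<Rightarrow> 'b"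
  where "simple_vector_integral M \<nu> s =
    (\<Sum>y\<in>s ` space M. y *\<^sub>R \<nu> (s -` {y} \<inter> space M))"

definition vector_measure_integral ::
    "'a measure \<Rightarrow> ('a set \<Rightarrow> 'b::real_normed_vector) \<Rightarrow> ('a \<Rightarrow> real) \<Rightarrow> 'b"
  where "vector_measure_integral M \<nu> f =
    (THE I. \<forall>s. (\<forall>k. simple_function M (s k)) \<and> uniform_limit (space M) s f sequentially
      \<longrightarrow> (\<lambda>k. simple_vector_integral M \<nu> (s k)) \<longlonglongrightarrow> I)"

definition sphere_op_vector ::
    "(real \<Rightarrow> real) \<Rightarrow> ((real ^ 'n) set \<Rightarrow> real ^ 'n) \<Rightarrow> real ^ 'n \<Rightarrow> real ^ 'n"
  where "sphere_op_vector K \<nu> z =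
    vector_measure_integral (restrict_space borel unit_sphere) \<nu> (\<lambda>\<omega>. K (z \<bullet> \<omega>))"

end

theory Submission
  imports Defs
begin

text \<open>
  Let \<open>H = \<K>\<N>\<^sub>\<gamma>\<close> and let \<open>F\<close> be a field of unit vectors with \<open>F \<bullet> H = norm H\<close>.
  The primitive \<open>\<Phi>\<close> of \<open>K\<close> is convex with subgradient \<open>K\<close>, so
  \<open>K t * u \<le> \<Phi> u + (t * K t - \<Phi> t)\<close>.  Put \<open>t = z \<bullet> \<omega>\<close>, \<open>u = x \<bullet> F z\<close> and integrate
  over \<open>\<gamma>\<close> and over \<open>z\<close>.  As \<open>F z\<close> is a unit vector and \<open>x\<close> has law \<open>\<mu>\<close>, rotation invariance
  makes the two integrals of \<open>\<Phi>\<close> cancel, for any law of \<open>\<omega>\<close>, and what remains is the integral of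
  \<open>t * K t\<close>, which is \<open>\<kappa>\<^sub>1\<close>.  On the diagonal coupling \<open>H z = \<kappa>\<^sub>1 z\<close>, and \<open>\<kappa>\<^sub>1 \<ge> 0\<close> by the bound itself.
\<close>

section \<open>Orthogonal invariance of Lebesgue measure\<close>

lemma borel_measurable_orthogonal_transformation:
  fixes T :: "'a::euclidean_space \<Rightarrow> 'a"
  assumes "orthogonal_transformation T"
  shows "T \<in> borel_measurable borel"
  by (intro borel_measurable_continuous_onI linear_continuous_on
      orthogonal_transformation_linear[OF assms, unfolded linear_conv_bounded_linear])

text \<open>
  The library's change of variables for linear maps needs a well-ordered index type.  Instead, as for
  the uniqueness of Haar measure, a double integral over \<open>A \<times> B\<close> is transformed by translations,
  with \<open>B\<close> the unit ball, which \<open>T\<close> preserves.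
\<close>

lemma emeasure_lborel_vimage_orthogonal:
  fixes T :: "'a::euclidean_space \<Rightarrow> 'a"
  assumes T: "orthogonal_transformation T" and A[measurable]: "A \<in> sets borel"
  shows "emeasure lborel (T -` A) = emeasure lborel A"
proof -
  have lin: "linear T" and bij: "bij T"
    using T orthogonal_transformation_linear orthogonal_transformation_bij by auto
  have Tm[measurable]: "T \<in> borel_measurable borel"
    by (rule borel_measurable_orthogonal_transformation[OF T])
  define B :: "'a set" where "B = ball 0 1"
  have B[measurable]: "B \<in> sets borel" by (simp add: B_def)
  have TB: "T -` B = B"
    using T by (auto simp: B_def orthogonal_transformation_norm)
  have shift: "(\<integral>\<^sup>+y. g (c + y) \<partial>lborel) = (\<integral>\<^sup>+y. g y \<partial>lborel)"
    if [measurable]: "g \<in> borel_measurable borel" for g :: "'a \<Rightarrow> ennreal" and c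
    using nn_integral_distr[of "(+) c" lborel borel g] by (simp add: lborel_distr_plus)
  have reflect: "(\<integral>\<^sup>+y. g (c - y) \<partial>lborel) = (\<integral>\<^sup>+y. g y \<partial>lborel)"
    if [measurable]: "g \<in> borel_measurable borel" for g :: "'a \<Rightarrow> ennreal" and c
  proof -
    have "(\<integral>\<^sup>+y. g y \<partial>lborel) =
        (\<integral>\<^sup>+y. g y \<partial>density (distr lborel borel (\<lambda>x. c + (-1) *\<^sub>R x)) (\<lambda>_. ennreal (\<bar>-1\<bar> ^ DIM('a))))"
      by (subst lborel_affine[of "-1" c]) simp_all
    also have "\<dots> = (\<integral>\<^sup>+y. g (c - y) \<partial>lborel)"
      by (subst nn_integral_density) (simp_all add: nn_integral_distr)
    finally show ?thesis by simp
  qed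
  have "emeasure lborel A * emeasure lborel (T -` B) =
      (\<integral>\<^sup>+y. (\<integral>\<^sup>+x. indicator A x * indicator B (T y) \<partial>lborel) \<partial>lborel)"
  proof -
    have "T -` B \<in> sets borel" using measurable_sets[OF Tm B] by simp
    then show ?thesis
      by (subst nn_integral_multc, simp) (simp add: nn_integral_cmult indicator_vimage[symmetric])
  qed
  \<comment> \<open>For fixed y the variable x is translated by \<open>T y\<close>, which brings y
    into the first indicator.\<close>
  also have "\<dots> = (\<integral>\<^sup>+y. (\<integral>\<^sup>+x. indicator A (T y + x) * indicator B (T y) \<partial>lborel) \<partial>lborel)"
    by (subst shift) simp_all
  also have "\<dots> = (\<integral>\<^sup>+x. (\<integral>\<^sup>+y. indicator A (T y + x) * indicator B (T y) \<partial>lborel) \<partial>lborel)"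
    by (rule lborel_pair.Fubini') measurable
  also have "\<dots> = (\<integral>\<^sup>+x. (\<integral>\<^sup>+y. indicator A (T y) * indicator B (T y - x) \<partial>lborel) \<partial>lborel)"
  proof (rule nn_integral_cong)
    fix x
    \<comment> \<open>Translating y by \<open>- inv T x\<close> moves \<open>T y\<close> by
      \<open>- x\<close>; this frees the first indicator from x and puts x into the second.\<close>
    have "T (- inv T x + y) = T y - x" for y
      using bij lin by (simp add: linear_add linear_neg linear_diff surj_f_inv_f bij_is_surj)
    then show "(\<integral>\<^sup>+y. indicator A (T y + x) * indicator B (T y) \<partial>lborel) =
        (\<integral>\<^sup>+y. indicator A (T y) * indicator B (T y - x) \<partial>lborel)"
      by (subst shift[of _ "- inv T x", symmetric]) simp_all
  qed
  also have "\<dots> = (\<integral>\<^sup>+y. (\<integral>\<^sup>+x. indicator A (T y) * indicator B (T y - x) \<partial>lborel) \<partial>lborel)"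
    by (rule lborel_pair.Fubini'[symmetric]) measurable
  \<comment> \<open>The integral over x is now the measure of \<open>B\<close> reflected about
    \<open>T y\<close>, the same for every y; what is left over y is the measure of the preimage of
    \<open>A\<close>.\<close>
  also have "\<dots> = emeasure lborel (T -` A) * emeasure lborel B"
  proof -
    have "T -` A \<in> sets borel" using measurable_sets[OF Tm A] by simp
    then show ?thesis
      by (subst nn_integral_cmult, simp, subst reflect)
        (simp_all add: nn_integral_multc indicator_vimage[symmetric])
  qed
  finally have "emeasure lborel A * emeasure lborel B = emeasure lborel (T -` A) * emeasure lborel B"
    by (simp add: TB)
  moreover have "emeasure lborel B \<noteq> \<infinity>"
    using emeasure_lborel_ball_finite[of "0 :: 'a" 1] by (auto simp: B_def)
  moreover have "emeasure lborel B \<noteq> 0"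
    using content_ball_pos[of 1 "0 :: 'a"] by (auto simp: measure_def B_def)
  ultimately show ?thesis
    by (auto simp: mult.commute[of _ "emeasure lborel B"] ennreal_mult_cancel_left)
qed

section \<open>Orthogonal invariance of the sphere measure\<close>

lemma measurable_ident_sphere_measure [measurable]: "(\<lambda>x. x) \<in> sphere_measure \<rightarrow>\<^sub>M borel"
  by (subst measurable_cong_sets[OF sets_sphere_measure refl])
    (intro measurable_restrict_space1 measurable_ident_sets refl)

lemma measurable_sphere_measureI:
  fixes f :: "real ^ 'n \<Rightarrow> 'b"
  shows "f \<in> borel \<rightarrow>\<^sub>M N \<Longrightarrow> f \<in> sphere_measure \<rightarrow>\<^sub>M N"
  using measurable_compose[OF measurable_ident_sphere_measure] by auto

lemma measurable_sphere_measure_orthogonal: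
  fixes T :: "real ^ 'n \<Rightarrow> real ^ 'n"
  assumes "orthogonal_transformation T"
  shows "T \<in> sphere_measure \<rightarrow>\<^sub>M sphere_measure"
proof -
  have "T \<in> sphere_measure \<rightarrow>\<^sub>M restrict_space borel unit_sphere"
    using assms
    by (intro measurable_restrict_space2 measurable_sphere_measureI
        borel_measurable_orthogonal_transformation) (auto simp: space_sphere_measure orthogonal_transformation_norm)
  then show ?thesis
    by (subst measurable_cong_sets[OF refl sets_sphere_measure])
qed

text \<open>\<open>T\<close> preserves norms and commutes with \<open>sgn\<close>, so the cone over
  the preimage of a set is the preimage of the cone \<open>C\<close> over it. The claim thus reduces
  to the Lebesgue measure of cones.\<close>

lemma distr_sphere_measure_orthogonal:
  fixes T :: "real ^ 'n \<Rightarrow> real ^ 'n"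
  assumes T: "orthogonal_transformation T"
  shows "distr sphere_measure sphere_measure T = sphere_measure"
proof (rule measure_eqI)
  note Tm = measurable_sphere_measure_orthogonal[OF T]
  fix A assume "A \<in> sets (distr sphere_measure sphere_measure T)"
  then have A: "A \<in> sets sphere_measure" by simp
  define C where "C = {x \<in> ball 0 1. sgn x \<in> A}"
  have Ab: "A \<in> sets borel"
    using A by (auto simp: sets_sphere_measure sets_restrict_space_iff)
  have m[measurable]: "(sgn :: real ^ 'n \<Rightarrow> _) \<in> borel_measurable borel"
    unfolding sgn_div_norm by measurable
  have C: "C \<in> sets borel"
    using measurable_sets[OF m Ab] unfolding C_def
    by (auto simp: vimage_def Collect_conj_eq intro!: sets.Int)
  have "T (sgn x) = sgn (T x)" for x
    using T by (simp add: sgn_div_norm orthogonal_transformation_norm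
        orthogonal_transformation_linear linear_cmul)
  then have eq: "{x \<in> ball 0 1. sgn x \<in> T -` A \<inter> unit_sphere} = T -` C - {0}"
    using A[THEN sets.sets_into_space] T
    by (auto simp: C_def space_sphere_measure orthogonal_transformation_norm norm_sgn split: if_splits)
  have "emeasure (distr sphere_measure sphere_measure T) A =
      emeasure lborel (T -` C - {0}) / emeasure lborel (ball 0 1 :: (real ^ 'n) set)"
    using measurable_sets[OF Tm A]
    by (subst emeasure_distr[OF Tm A], unfold space_sphere_measure, subst emeasure_sphere_measure)
      (simp_all only: eq sets_sphere_measure)
  also have "emeasure lborel (T -` C - {0}) = emeasure lborel (T -` C)"
    using measurable_sets[OF borel_measurable_orthogonal_transformation[OF T] C]
    by (intro emeasure_Diff_null_set) auto
  also have "\<dots> = emeasure lborel C"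
    by (rule emeasure_lborel_vimage_orthogonal[OF T C])
  also have "\<dots> / emeasure lborel (ball 0 1 :: (real ^ 'n) set) = emeasure sphere_measure A"
    using A by (subst emeasure_sphere_measure) (simp_all add: C_def sets_sphere_measure)
  finally show "emeasure (distr sphere_measure sphere_measure T) A = emeasure sphere_measure A" .
qed simp

lemma integral_sphere_measure_orthogonal:
  fixes T :: "real ^ 'n \<Rightarrow> real ^ 'n" and f :: "real ^ 'n \<Rightarrow> 'b::{banach, second_countable_topology}"
  assumes "orthogonal_transformation T" and "f \<in> borel_measurable sphere_measure"
  shows "(\<integral>x. f (T x) \<partial>sphere_measure) = (\<integral>x. f x \<partial>sphere_measure)"
  using integral_distr[OF measurable_sphere_measure_orthogonal[OF assms(1)] assms(2)]
  by (simp add: distr_sphere_measure_orthogonal[OF assms(1)])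

section \<open>Zonal integrals and the degree-one multiplier\<close>

text \<open>Orthogonal maps act transitively on each sphere about the origin. As a consequence,
  every zonal integral can be evaluated at one fixed pole.\<close>

lemma integral_zonal_eq:
  fixes z w :: "real ^ 'n" and f :: "real \<Rightarrow> real"
  assumes "norm z = norm w" and [measurable]: "f \<in> borel_measurable borel"
  shows "(\<integral>\<omega>. f (z \<bullet> \<omega>) \<partial>sphere_measure) = (\<integral>\<omega>. f (w \<bullet> \<omega>) \<partial>sphere_measure)"
proof -
  obtain T where T: "orthogonal_transformation T" "T z = w"
    using orthogonal_transformation_exists[OF assms(1)] by blast
  have "(\<integral>\<omega>. f (w \<bullet> \<omega>) \<partial>sphere_measure) = (\<integral>\<omega>. f (w \<bullet> T \<omega>) \<partial>sphere_measure)"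
    by (rule integral_sphere_measure_orthogonal[OF T(1), symmetric]) measurable
  also have "\<dots> = (\<integral>\<omega>. f (z \<bullet> \<omega>) \<partial>sphere_measure)"
    using T by (auto simp: orthogonal_transformation_def)
  finally show ?thesis by simp
qed

lemma abs_inner_unit_sphere_le:
  "norm z = 1 \<Longrightarrow> norm \<omega> = 1 \<Longrightarrow> \<bar>z \<bullet> \<omega>\<bar> \<le> 1"
  using Cauchy_Schwarz_ineq2[of z \<omega>] by simp

lemma integrable_sphere_measure_bounded:
  fixes f :: "real ^ 'n \<Rightarrow> 'b::{banach, second_countable_topology}"
  assumes "f \<in> borel_measurable sphere_measure" and "\<And>\<omega>. norm \<omega> = 1 \<Longrightarrow> norm (f \<omega>) \<le> B"
  shows "integrable sphere_measure f"
proof -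
  interpret prob_space "sphere_measure :: (real ^ 'n) measure" by (rule prob_space_sphere_measure)
  show ?thesis
    by (rule integrable_const_bound[where B = B]) (use assms in \<open>auto simp: space_sphere_measure\<close>)
qed

lemma integral_zonal_times_ident:
  fixes z :: "real ^ 'n" and K :: "real \<Rightarrow> real"
  assumes z: "norm z = 1" and [measurable]: "K \<in> borel_measurable borel"
    and bd: "\<And>t. \<bar>K t\<bar> \<le> B"
  shows "(\<integral>\<omega>. K (z \<bullet> \<omega>) *\<^sub>R \<omega> \<partial>sphere_measure) =
    (\<integral>\<omega>. K (z \<bullet> \<omega>) * (z \<bullet> \<omega>) \<partial>sphere_measure) *\<^sub>R z"
proof -
  \<comment> \<open>The rotation by \<open>\<pi>\<close> about the axis \<open>z\<close> negates the part of the integral orthogonal to \<open>z\<close>.\<close>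
  define T where "T = (\<lambda>\<omega>. (2 * (z \<bullet> \<omega>)) *\<^sub>R z - \<omega>)"
  have zz: "z \<bullet> z = 1" using z by (simp add: norm_eq_1)
  have T: "orthogonal_transformation T"
    unfolding orthogonal_transformation_def
    by (auto simp: T_def linear_iff algebra_simps zz inner_commute)
  have zT: "z \<bullet> T \<omega> = z \<bullet> \<omega>" for \<omega>
    by (simp add: T_def algebra_simps zz)
  have i1: "integrable sphere_measure (\<lambda>\<omega>. K (z \<bullet> \<omega>) *\<^sub>R \<omega>)"
    by (rule integrable_sphere_measure_bounded[where B = B]) (use bd in auto)
  have i2: "integrable sphere_measure (\<lambda>\<omega>. K (z \<bullet> \<omega>) * (z \<bullet> \<omega>))"
    using integrable_inner_right[of z, OF i1] by simp
  let ?v = "\<integral>\<omega>. K (z \<bullet> \<omega>) *\<^sub>R \<omega> \<partial>sphere_measure"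
  let ?k = "\<integral>\<omega>. K (z \<bullet> \<omega>) * (z \<bullet> \<omega>) \<partial>sphere_measure"
  have "?v = (\<integral>\<omega>. K (z \<bullet> T \<omega>) *\<^sub>R T \<omega> \<partial>sphere_measure)"
    by (rule integral_sphere_measure_orthogonal[OF T, symmetric]) measurable
  also have "\<dots> = (\<integral>\<omega>. (2 * (K (z \<bullet> \<omega>) * (z \<bullet> \<omega>))) *\<^sub>R z - K (z \<bullet> \<omega>) *\<^sub>R \<omega> \<partial>sphere_measure)"
    by (simp add: zT) (simp add: T_def algebra_simps)
  also have "\<dots> = (2 * ?k) *\<^sub>R z - ?v"
    using i1 i2 by (subst Bochner_Integration.integral_diff) auto
  finally have "2 *\<^sub>R ?v = 2 *\<^sub>R (?k *\<^sub>R z)"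
    by (simp add: scaleR_2 algebra_simps)
  then show ?thesis by (simp only: scaleR_cancel_left) simp
qed

text \<open>Applying a linear form to the vector identity of
  \<open>integral_zonal_times_ident\<close> shows that the integral acts as a multiplier, and
  \<open>integral_zonal_eq\<close> makes it independent of the pole.\<close>

lemma degree_one_multiplier_eq:
  fixes z :: "real ^ 'n" and K :: "real \<Rightarrow> real"
  assumes z: "norm z = 1" and [measurable]: "K \<in> borel_measurable borel"
    and bd: "\<And>t. \<bar>K t\<bar> \<le> B"
  shows "degree_one_multiplier TYPE('n) K = (\<integral>\<omega>. K (z \<bullet> \<omega>) * (z \<bullet> \<omega>) \<partial>sphere_measure)"
    (is "_ = ?k")
  unfolding degree_one_multiplier_def
proof (rule the_equality; safe?)
  fix Y :: "real ^ 'n \<Rightarrow> real" and w :: "real ^ 'n"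
  assume Y: "linear Y" and "w \<in> unit_sphere"
  then have w: "norm w = 1" by simp
  have Yb: "bounded_linear Y" using Y by (simp add: linear_conv_bounded_linear)
  have i1: "integrable sphere_measure (\<lambda>\<omega>. K (w \<bullet> \<omega>) *\<^sub>R \<omega>)"
    by (rule integrable_sphere_measure_bounded[where B = B]) (use bd in auto)
  have "sphere_op K Y w = (\<integral>\<omega>. Y (K (w \<bullet> \<omega>) *\<^sub>R \<omega>) \<partial>sphere_measure)"
    using Y by (simp add: sphere_op_def linear_cmul)
  also have "\<dots> = Y (\<integral>\<omega>. K (w \<bullet> \<omega>) *\<^sub>R \<omega> \<partial>sphere_measure)"
    by (rule integral_bounded_linear[OF Yb i1])
  also have "\<dots> = (\<integral>\<omega>. K (w \<bullet> \<omega>) * (w \<bullet> \<omega>) \<partial>sphere_measure) * Y w"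
    using Y by (subst integral_zonal_times_ident[OF w _ bd]) (simp_all add: linear_cmul)
  also have "(\<integral>\<omega>. K (w \<bullet> \<omega>) * (w \<bullet> \<omega>) \<partial>sphere_measure) = ?k"
    using integral_zonal_eq[of w z "\<lambda>t. K t * t"] z w by simp
  finally show "sphere_op K Y w = ?k * Y w" .
next
  fix \<kappa>
  assume *: "\<forall>Y :: real ^ 'n \<Rightarrow> real. linear Y \<longrightarrow> (\<forall>w\<in>unit_sphere. sphere_op K Y w = \<kappa> * Y w)"
  \<comment> \<open>For uniqueness a single test suffices: the linear form given by the inner
    product with z takes the value 1 at z.\<close>
  have "sphere_op K (\<lambda>\<omega>. z \<bullet> \<omega>) z = \<kappa> * (z \<bullet> z)"
    using * z by (simp add: bounded_linear.linear bounded_linear_inner_right)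
  then show "\<kappa> = ?k"
    using z by (simp add: sphere_op_def norm_eq_1)
qed

section \<open>Integration against a vector measure\<close>

text \<open>Here \<nu> is the image under \<open>Y\<close> of the measure with vector density
  \<open>X\<close> with respect to \<gamma>. The finite sum over level sets goes inside the
  integral, where at each p only the level set containing \<open>Y p\<close> contributes.\<close>

lemma simple_vector_integral_eq:
  fixes X :: "'c \<Rightarrow> 'b::{banach, second_countable_topology}"
  assumes Y: "Y \<in> \<gamma> \<rightarrow>\<^sub>M M" and X: "integrable \<gamma> X"
    and \<nu>: "\<And>E. E \<in> sets M \<Longrightarrow> \<nu> E = (\<integral>p. indicator E (Y p) *\<^sub>R X p \<partial>\<gamma>)"
    and s: "simple_function M s"
  shows "simple_vector_integral M \<nu> s = (\<integral>p. s (Y p) *\<^sub>R X p \<partial>\<gamma>)"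
proof -
  let ?E = "\<lambda>y. s -` {y} \<inter> space M"
  have E: "?E y \<in> sets M" for y
    using simple_functionD(2)[OF s, of "{y}"] .
  have fin: "finite (s ` space M)" by (rule simple_functionD(1)[OF s])
  have int: "integrable \<gamma> (\<lambda>p. indicator (?E y) (Y p) *\<^sub>R X p)" for y
  proof -
    have "Y -` ?E y \<inter> space \<gamma> \<in> sets \<gamma>" by (rule measurable_sets[OF Y E])
    then have "integrable \<gamma> (\<lambda>p. indicator (Y -` ?E y \<inter> space \<gamma>) p *\<^sub>R X p)"
      by (rule integrable_mult_indicator[OF _ X])
    then show ?thesis
      by (rule Bochner_Integration.integrable_cong[THEN iffD1, rotated 2])
        (auto simp: indicator_def)
  qed
  have "simple_vector_integral M \<nu> s =
      (\<Sum>y\<in>s ` space M. y *\<^sub>R (\<integral>p. indicator (?E y) (Y p) *\<^sub>R X p \<partial>\<gamma>))"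
    by (simp add: simple_vector_integral_def \<nu>[OF E])
  also have "\<dots> = (\<integral>p. (\<Sum>y\<in>s ` space M. y *\<^sub>R indicator (?E y) (Y p) *\<^sub>R X p) \<partial>\<gamma>)"
    using int by (subst Bochner_Integration.integral_sum) (auto simp del: scaleR_scaleR)
  also have "\<dots> = (\<integral>p. s (Y p) *\<^sub>R X p \<partial>\<gamma>)"
  proof (rule Bochner_Integration.integral_cong[OF refl])
    fix p assume "p \<in> space \<gamma>"
    then have Yp: "Y p \<in> space M" using Y by (rule measurable_space[rotated])
    have "(\<Sum>y\<in>s ` space M. y *\<^sub>R indicator (?E y) (Y p) *\<^sub>R X p) =
        (\<Sum>y\<in>s ` space M. if s (Y p) = y then y *\<^sub>R X p else 0)"
      using Yp by (intro sum.cong) auto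
    also have "\<dots> = s (Y p) *\<^sub>R X p" using fin Yp by simp
    finally show "(\<Sum>y\<in>s ` space M. y *\<^sub>R indicator (?E y) (Y p) *\<^sub>R X p) = s (Y p) *\<^sub>R X p" .
  qed
  finally show ?thesis .
qed

text \<open>Rounding f down to multiples of 1/(k+1) leaves finitely many values because f is
  bounded, with an error of at most 1/(k+1) everywhere. The existence of such a sequence is what
  makes the limit in \<open>vector_measure_integral\<close> unique.\<close>

lemma uniform_limit_simple_function:
  fixes f :: "'a \<Rightarrow> real"
  assumes f[measurable]: "f \<in> borel_measurable M" and bd: "\<And>x. x \<in> space M \<Longrightarrow> \<bar>f x\<bar> \<le> B"
  obtains s where "\<And>k. simple_function M (s k)" "uniform_limit (space M) s f sequentially"
proof
  define s where "s = (\<lambda>k x. of_int \<lfloor>real (Suc k) * f x\<rfloor> / real (Suc k))"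
  show "simple_function M (s k)" for k
  proof (rule simple_function_borel_measurable)
    show "s k \<in> borel_measurable M" unfolding s_def by measurable
    let ?I = "{\<lfloor>- (real (Suc k) * B)\<rfloor>..\<lfloor>real (Suc k) * B\<rfloor>}"
    have "s k ` space M \<subseteq> (\<lambda>i. of_int i / real (Suc k)) ` ?I"
    proof
      fix y assume "y \<in> s k ` space M"
      then obtain x where x: "x \<in> space M" "y = s k x" by auto
      have "\<bar>real (Suc k) * f x\<bar> \<le> real (Suc k) * B"
        unfolding abs_mult using bd[OF x(1)] by (intro mult_mono) auto
      then have "- (real (Suc k) * B) \<le> real (Suc k) * f x \<and> real (Suc k) * f x \<le> real (Suc k) * B"
        by linarith
      then have "\<lfloor>real (Suc k) * f x\<rfloor> \<in> ?I"
        unfolding atLeastAtMost_iff by (blast intro: floor_mono)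
      then show "y \<in> (\<lambda>i. of_int i / real (Suc k)) ` ?I"
        unfolding x(2) s_def by (rule imageI)
    qed
    then show "finite (s k ` space M)" by (rule finite_subset) simp
  qed
  show "uniform_limit (space M) s f sequentially"
  proof (rule uniform_limitI)
    fix e :: real assume "e > 0"
    have "\<forall>\<^sub>F k in sequentially. inverse (real (Suc k)) < e"
      using LIMSEQ_inverse_real_of_nat \<open>e > 0\<close> by (rule order_tendstoD)
    then show "\<forall>\<^sub>F k in sequentially. \<forall>x\<in>space M. dist (s k x) (f x) < e"
    proof (eventually_elim, intro ballI)
      fix k x assume k: "inverse (real (Suc k)) < e"
      have "dist (s k x) (f x) =
          \<bar>of_int \<lfloor>real (Suc k) * f x\<rfloor> - real (Suc k) * f x\<bar> / real (Suc k)"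
      proof -
        have "s k x - f x = (of_int \<lfloor>real (Suc k) * f x\<rfloor> - real (Suc k) * f x) / real (Suc k)"
          by (simp add: s_def diff_divide_distrib del: of_nat_Suc)
        then show ?thesis by (simp add: dist_real_def del: of_nat_Suc)
      qed
      also have "\<dots> \<le> 1 / real (Suc k)"
        by (rule divide_right_mono) (linarith, simp)
      finally show "dist (s k x) (f x) < e" using k by (simp add: divide_inverse)
    qed
  qed
qed

text \<open>Since \<open>X\<close> is integrable, replacing f by a simple function costs at most the
  uniform error times the integral of the norm of \<open>X\<close>.\<close>

lemma vector_measure_integral_eq:
  fixes X :: "'c \<Rightarrow> 'b::{banach, second_countable_topology}"
  assumes Y: "Y \<in> \<gamma> \<rightarrow>\<^sub>M M" and X: "integrable \<gamma> X"
    and \<nu>: "\<And>E. E \<in> sets M \<Longrightarrow> \<nu> E = (\<integral>p. indicator E (Y p) *\<^sub>R X p \<partial>\<gamma>)"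
    and f: "f \<in> borel_measurable M" and bd: "\<And>x. x \<in> space M \<Longrightarrow> \<bar>f x\<bar> \<le> B"
  shows "vector_measure_integral M \<nu> f = (\<integral>p. f (Y p) *\<^sub>R X p \<partial>\<gamma>)" (is "_ = ?I")
proof -
  have int: "integrable \<gamma> (\<lambda>p. g (Y p) *\<^sub>R X p)"
    if g: "g \<in> borel_measurable M" and bd: "\<And>x. x \<in> space M \<Longrightarrow> \<bar>g x\<bar> \<le> C" for g and C :: real
  proof (rule Bochner_Integration.integrable_bound[where f = "\<lambda>p. C *\<^sub>R X p"])
    show "(\<lambda>p. g (Y p) *\<^sub>R X p) \<in> borel_measurable \<gamma>"
      using measurable_compose[OF Y g] X by simp
    show "AE p in \<gamma>. norm (g (Y p) *\<^sub>R X p) \<le> norm (C *\<^sub>R X p)"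
      using bd[OF measurable_space[OF Y]] by (intro AE_I2) (fastforce intro!: mult_right_mono)
  qed (use X in simp)
  have lim: "(\<lambda>k. simple_vector_integral M \<nu> (s k)) \<longlonglongrightarrow> ?I"
    if s: "\<And>k. simple_function M (s k)" and u: "uniform_limit (space M) s f sequentially" for s
  proof (rule tendstoI)
    fix e :: real assume e: "e > 0"
    define N where "N = (\<integral>p. norm (X p) \<partial>\<gamma>)"
    have N: "N \<ge> 0" by (simp add: N_def)
    \<comment> \<open>Dividing by \<open>N + 1\<close> covers the case N = 0 and leaves the factor
      N/(N+1) < 1 that makes the final inequality strict.\<close>
    have "\<forall>\<^sub>F k in sequentially. \<forall>x\<in>space M. dist (s k x) (f x) < e / (N + 1)"
      by (rule uniform_limitD[OF u]) (use e N in auto)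
    then show "\<forall>\<^sub>F k in sequentially. dist (simple_vector_integral M \<nu> (s k)) ?I < e"
    proof eventually_elim
      fix k assume k: "\<forall>x\<in>space M. dist (s k x) (f x) < e / (N + 1)"
      have sb: "\<bar>s k x\<bar> \<le> B + e / (N + 1)" if "x \<in> space M" for x
        using k bd that by (fastforce simp: dist_real_def)
      have i1: "integrable \<gamma> (\<lambda>p. s k (Y p) *\<^sub>R X p)"
        by (rule int[OF borel_measurable_simple_function[OF s] sb])
      have i2: "integrable \<gamma> (\<lambda>p. f (Y p) *\<^sub>R X p)"
        by (rule int[OF f bd])
      have "dist (simple_vector_integral M \<nu> (s k)) ?I =
          norm (\<integral>p. (s k (Y p) - f (Y p)) *\<^sub>R X p \<partial>\<gamma>)"
        using i1 i2 by (simp add: simple_vector_integral_eq[OF Y X \<nu> s] dist_norm scaleR_diff_left)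
      also have "\<dots> \<le> (\<integral>p. e / (N + 1) * norm (X p) \<partial>\<gamma>)"
      proof (rule order_trans[OF integral_norm_bound Bochner_Integration.integral_mono])
        show "integrable \<gamma> (\<lambda>p. norm ((s k (Y p) - f (Y p)) *\<^sub>R X p))"
          using i1 i2 by (intro integrable_norm) (simp add: scaleR_diff_left)
        show "norm ((s k (Y p) - f (Y p)) *\<^sub>R X p) \<le> e / (N + 1) * norm (X p)"
          if "p \<in> space \<gamma>" for p
          unfolding norm_scaleR using k measurable_space[OF Y that]
          by (intro mult_right_mono) (auto simp: dist_real_def less_imp_le)
      qed (use X in simp)
      also have "\<dots> = e * (N / (N + 1))" by (simp add: N_def)
      also have "\<dots> < e * 1" using e N by (intro mult_strict_left_mono) auto
      finally show "dist (simple_vector_integral M \<nu> (s k)) ?I < e" by simp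
    qed
  qed
  obtain s where s: "\<And>k. simple_function M (s k)" "uniform_limit (space M) s f sequentially"
    using uniform_limit_simple_function[OF f bd] by blast
  show ?thesis
    unfolding vector_measure_integral_def
  proof (rule the_equality)
    show "\<forall>s. (\<forall>k. simple_function M (s k)) \<and> uniform_limit (space M) s f sequentially \<longrightarrow>
        (\<lambda>k. simple_vector_integral M \<nu> (s k)) \<longlonglongrightarrow> ?I"
      using lim by blast
  next
    fix I
    assume "\<forall>s. (\<forall>k. simple_function M (s k)) \<and> uniform_limit (space M) s f sequentially \<longrightarrow>
        (\<lambda>k. simple_vector_integral M \<nu> (s k)) \<longlonglongrightarrow> I"
    then show "I = ?I" using s lim LIMSEQ_unique by blast
  qed
qed

section \<open>The convex primitive of a monotone kernel\<close>

text \<open>Between t and u the function K stays on one side of \<open>K t\<close>, above it if t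
  \<le> u and below it otherwise; the sign of u - t turns both cases into the same
  inequality.\<close>

lemma integral_mono_on_subgradient:
  fixes K :: "real \<Rightarrow> real"
  assumes K: "mono K" and t: "a \<le> t" and u: "a \<le> u"
  shows "K t * (u - t) \<le> integral {a..u} K - integral {a..t} K"
proof -
  have int: "K integrable_on {b..c}" for b c
    using K by (intro integrable_on_mono_on) (simp add: mono_imp_mono_on)
  show ?thesis
  proof (cases "t \<le> u")
    case True
    have "K t * (u - t) = integral {t..u} (\<lambda>_. K t)" using True by simp
    also have "\<dots> \<le> integral {t..u} K"
      using K int by (intro integral_le) (auto dest: monoD)
    also have "\<dots> = integral {a..u} K - integral {a..t} K"
      using Henstock_Kurzweil_Integration.integral_combine[OF t True int] by simp
    finally show ?thesis .
  next
    case False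
    have "integral {a..t} K - integral {a..u} K = integral {u..t} K"
      using Henstock_Kurzweil_Integration.integral_combine[OF u _ int, of t] False by simp
    also have "\<dots> \<le> integral {u..t} (\<lambda>_. K t)"
      using K int by (intro integral_le) (auto dest: monoD)
    also have "\<dots> = K t * (t - u)" using False by simp
    finally show ?thesis by (simp add: algebra_simps)
  qed
qed

text \<open>For u below a the interval is empty and the integral is 0, so monotonicity holds on the
  whole line. It supplies both the measurability and the bounds of the primitive.\<close>

lemma mono_integral_nonneg:
  fixes K :: "real \<Rightarrow> real"
  assumes K: "mono K" and nonneg: "\<And>t. 0 \<le> K t"
  shows "mono (\<lambda>u. integral {a..u} K)"
proof
  fix t u :: real assume "t \<le> u"
  have int: "K integrable_on {b..c}" for b c
    using K by (intro integrable_on_mono_on) (simp add: mono_imp_mono_on)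
  show "integral {a..t} K \<le> integral {a..u} K"
    by (rule integral_subset_le) (use int nonneg \<open>t \<le> u\<close> in auto)
qed

section \<open>The upper bound for an arbitrary coupling\<close>

context
  fixes \<gamma> :: "((real ^ 'n) \<times> (real ^ 'n)) measure"
  assumes coupling: "sphere_coupling \<gamma>"
begin

lemma sets_coupling: "sets \<gamma> = sets (restrict_space borel (unit_sphere \<times> unit_sphere))"
  using coupling by (simp add: sphere_coupling_def)

lemma space_coupling: "space \<gamma> = unit_sphere \<times> unit_sphere"
  using sets_eq_imp_space_eq[OF sets_coupling] by (simp add: space_restrict_space)

lemma prob_space_coupling: "prob_space \<gamma>"
  using coupling by (simp add: sphere_coupling_def)

lemma measurable_fst_coupling: "fst \<in> borel_measurable \<gamma>"
  by (subst measurable_cong_sets[OF sets_coupling refl])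
    (intro measurable_restrict_space1 borel_measurable_continuous_onI continuous_on_fst continuous_on_id)

lemma measurable_snd_coupling: "snd \<in> borel_measurable \<gamma>"
  by (subst measurable_cong_sets[OF sets_coupling refl])
    (intro measurable_restrict_space1 borel_measurable_continuous_onI continuous_on_snd continuous_on_id)

lemma measurable_snd_coupling_sphere: "snd \<in> \<gamma> \<rightarrow>\<^sub>M restrict_space borel unit_sphere"
  by (rule measurable_restrict_space2[OF _ measurable_snd_coupling]) (auto simp: space_coupling)

text \<open>The condition on the first marginal enters the estimate through this lemma
  alone.\<close>

lemma integral_coupling_fst:
  fixes f :: "real ^ 'n \<Rightarrow> 'b::{banach, second_countable_topology}"
  assumes [measurable]: "f \<in> borel_measurable borel"
  shows "(\<integral>p. f (fst p) \<partial>\<gamma>) = (\<integral>x. f x \<partial>sphere_measure)"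
proof -
  have "fst \<in> \<gamma> \<rightarrow>\<^sub>M restrict_space borel unit_sphere"
    by (rule measurable_restrict_space2[OF _ measurable_fst_coupling]) (auto simp: space_coupling)
  moreover have "f \<in> borel_measurable (restrict_space borel unit_sphere)"
    by (rule measurable_restrict_space1) measurable
  ultimately have "(\<integral>x. f x \<partial>distr \<gamma> (restrict_space borel unit_sphere) fst) = (\<integral>p. f (fst p) \<partial>\<gamma>)"
    by (rule integral_distr)
  then show ?thesis using coupling by (simp add: sphere_coupling_def)
qed

lemma integrable_coupling_bounded:
  fixes f :: "(real ^ 'n) \<times> (real ^ 'n) \<Rightarrow> 'b::{banach, second_countable_topology}"
  assumes "f \<in> borel_measurable \<gamma>"
    and "\<And>x \<omega>. norm x = 1 \<Longrightarrow> norm \<omega> = 1 \<Longrightarrow> norm (f (x, \<omega>)) \<le> B"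
  shows "integrable \<gamma> f"
proof -
  interpret prob_space \<gamma> by (rule prob_space_coupling)
  show ?thesis
    by (rule integrable_const_bound[where B = B]) (use assms in \<open>auto simp: space_coupling\<close>)
qed

lemma sphere_op_vector_coupling:
  fixes K :: "real \<Rightarrow> real" and z :: "real ^ 'n"
  assumes [measurable]: "K \<in> borel_measurable borel" and bd: "\<And>t. \<bar>K t\<bar> \<le> B"
  shows "sphere_op_vector K (coupling_vector_measure \<gamma>) z = (\<integral>p. K (z \<bullet> snd p) *\<^sub>R fst p \<partial>\<gamma>)"
  unfolding sphere_op_vector_def
proof (rule vector_measure_integral_eq[OF measurable_snd_coupling_sphere])
  show "integrable \<gamma> fst"
    by (rule integrable_coupling_bounded[OF measurable_fst_coupling, where B = 1]) simp
  \<comment> \<open>Membership of x in the sphere is automatic on the space of \<gamma>, so only the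
    indicator of E survives in the set integral.\<close>
  show "coupling_vector_measure \<gamma> E = (\<integral>p. indicator E (snd p) *\<^sub>R fst p \<partial>\<gamma>)" for E
    unfolding coupling_vector_measure_def set_lebesgue_integral_def
    by (rule Bochner_Integration.integral_cong) (auto simp: space_coupling indicator_def)
  show "(\<lambda>\<omega>. K (z \<bullet> \<omega>)) \<in> borel_measurable (restrict_space borel unit_sphere)"
    by (rule measurable_restrict_space1) measurable
qed (use bd in auto)

text \<open>A bound on \<open>norm (H z)\<close> is proved for each z separately and then
  integrated. The direction F is chosen inside that pointwise bound, whose right-hand side no longer
  contains it, so no measurable selection of directions is involved.\<close>

lemma
  fixes K :: "real \<Rightarrow> real" and e :: "real ^ 'n"
  assumes mono: "mono K" and nonneg: "\<And>t. 0 \<le> K t" and bd: "\<And>t. K t \<le> B" and e: "norm e = 1"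
  defines "H \<equiv> \<lambda>z :: real ^ 'n. \<integral>p. K (z \<bullet> snd p) *\<^sub>R fst p \<partial>\<gamma>"
  shows integrable_coupling_kernel: "integrable sphere_measure H"
    and integral_norm_coupling_kernel_le: "(\<integral>z. norm (H z) \<partial>sphere_measure) \<le>
      (\<integral>\<omega>. K (e \<bullet> \<omega>) * (e \<bullet> \<omega>) \<partial>sphere_measure)"
proof -
  note measurable_fst_coupling[measurable] measurable_snd_coupling[measurable]
  note sb = integrable_sphere_measure_bounded and cb = integrable_coupling_bounded
  interpret \<gamma>: prob_space \<gamma> by (rule prob_space_coupling)
  interpret \<mu>: prob_space "sphere_measure :: (real ^ 'n) measure" by (rule prob_space_sphere_measure)
  interpret P: pair_prob_space "sphere_measure :: (real ^ 'n) measure" \<gamma> ..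
  \<comment> \<open>Starting the primitive at -1 gives \<open>\<Phi> (-1) = 0\<close>, hence values
    between 0 and \<open>\<Phi> 1\<close> on [-1,1]. For t in that interval \<open>g t\<close> is
    the convex conjugate of \<Phi> at the slope \<open>K t\<close>, and \<open>young\<close> is the
    Fenchel-Young inequality, with equality at u = t.\<close>
  define \<Phi> where "\<Phi> = (\<lambda>u. integral {-1..u} K)"
  define g where "g = (\<lambda>t. K t * t - \<Phi> t)"
  have K[measurable]: "K \<in> borel_measurable borel"
    by (rule borel_measurable_mono[OF mono])
  have mono\<Phi>: "mono \<Phi>"
    unfolding \<Phi>_def by (rule mono_integral_nonneg[OF mono nonneg])
  then have \<Phi>[measurable]: "\<Phi> \<in> borel_measurable borel"
    by (rule borel_measurable_mono)
  have g[measurable]: "g \<in> borel_measurable borel"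
    unfolding g_def by measurable
  have absK: "\<bar>K t\<bar> \<le> B" for t using nonneg[of t] bd[of t] by simp
  have \<Phi>b: "\<bar>\<Phi> t\<bar> \<le> \<Phi> 1" if "\<bar>t\<bar> \<le> 1" for t
    using that monoD[OF mono\<Phi>, of "-1" t] monoD[OF mono\<Phi>, of t 1] by (simp add: \<Phi>_def)
  have gb: "\<bar>g t\<bar> \<le> B + \<Phi> 1" if "\<bar>t\<bar> \<le> 1" for t
  proof -
    have "\<bar>K t\<bar> * \<bar>t\<bar> \<le> B * 1" using absK[of t] that by (intro mult_mono) auto
    then show ?thesis using \<Phi>b[OF that] by (simp add: g_def abs_mult[symmetric])
  qed
  have young: "K t * u \<le> \<Phi> u + g t" if "\<bar>t\<bar> \<le> 1" "\<bar>u\<bar> \<le> 1" for t u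
    using integral_mono_on_subgradient[OF mono, of "-1" t u] that
    by (simp add: \<Phi>_def g_def algebra_simps)
  have Hm[measurable]: "H \<in> borel_measurable sphere_measure"
    unfolding H_def by (rule \<gamma>.borel_measurable_lebesgue_integral) measurable
  have Hb: "norm (H z) \<le> B" for z
  proof -
    have "norm (H z) \<le> (\<integral>p. norm (K (z \<bullet> snd p) *\<^sub>R fst p) \<partial>\<gamma>)"
      unfolding H_def by (rule integral_norm_bound)
    also have "\<dots> \<le> (\<integral>p. B \<partial>\<gamma>)"
      by (rule Bochner_Integration.integral_mono, rule cb[where B = B]) 
        (use absK in \<open>auto simp: space_coupling\<close>)
    finally show ?thesis by (simp add: \<gamma>.prob_space)
  qed
  show Hint: "integrable sphere_measure H"
    by (rule sb[OF Hm Hb])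
  define c where "c = (\<integral>x. \<Phi> (e \<bullet> x) \<partial>sphere_measure)"
  have pointwise: "norm (H z) \<le> c + (\<integral>p. g (z \<bullet> snd p) \<partial>\<gamma>)" if z: "norm z = 1" for z
  proof -
    \<comment> \<open>\<open>sgn\<close> vanishes at 0, so the default \<open>e\<close> is what
      keeps F a unit vector when \<open>H z = 0\<close>.\<close>
    define F where "F = (if H z = 0 then e else sgn (H z))"
    have F: "norm F = 1" using e by (simp add: F_def norm_sgn)
    have F_le: "\<bar>F \<bullet> x\<bar> \<le> 1" if "norm x = 1" for x
      by (rule abs_inner_unit_sphere_le[OF F that])
    have "norm (H z) = F \<bullet> H z"
      by (simp add: F_def sgn_div_norm power2_norm_eq_inner[symmetric] power2_eq_square)
    also have "\<dots> = (\<integral>p. F \<bullet> (K (z \<bullet> snd p) *\<^sub>R fst p) \<partial>\<gamma>)"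
      unfolding H_def
      by (rule integral_inner_right[symmetric], rule cb[where B = B]) (use absK in auto)
    also have "\<dots> \<le> (\<integral>p. \<Phi> (F \<bullet> fst p) + g (z \<bullet> snd p) \<partial>\<gamma>)"
    proof (rule Bochner_Integration.integral_mono)
      show "integrable \<gamma> (\<lambda>p. F \<bullet> (K (z \<bullet> snd p) *\<^sub>R fst p))"
        by (rule integrable_inner_right, rule cb[where B = B]) (use absK in auto)
      show "integrable \<gamma> (\<lambda>p. \<Phi> (F \<bullet> fst p) + g (z \<bullet> snd p))"
        by (intro Bochner_Integration.integrable_add cb[where B = "\<Phi> 1"] cb[where B = "B + \<Phi> 1"])
          (auto intro!: \<Phi>b gb abs_inner_unit_sphere_le F z)
    qed (auto simp: space_coupling intro!: young abs_inner_unit_sphere_le F z)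
    also have "\<dots> = (\<integral>p. \<Phi> (F \<bullet> fst p) \<partial>\<gamma>) + (\<integral>p. g (z \<bullet> snd p) \<partial>\<gamma>)"
      by (intro Bochner_Integration.integral_add cb[where B = "\<Phi> 1"] cb[where B = "B + \<Phi> 1"])
        (auto intro!: \<Phi>b gb abs_inner_unit_sphere_le F z)
    \<comment> \<open>The first marginal turns this into a zonal integral over the sphere, and
      rotation invariance then replaces the pole F by \<open>e\<close>.\<close>
    also have "(\<integral>p. \<Phi> (F \<bullet> fst p) \<partial>\<gamma>) = (\<integral>x. \<Phi> (F \<bullet> x) \<partial>sphere_measure)"
      by (rule integral_coupling_fst) measurable
    also have "\<dots> = c"
      unfolding c_def by (rule integral_zonal_eq) (simp_all add: F e)
    finally show ?thesis .
  qed
  \<comment> \<open>Joint integrability, from boundedness on a product of probability spaces,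
    justifies exchanging the integrals over z and over \<gamma>.\<close>
  have gint: "integrable (sphere_measure \<Otimes>\<^sub>M \<gamma>) (\<lambda>(z, p). g (z \<bullet> snd p))"
    by (rule P.integrable_const_bound[where B = "B + \<Phi> 1"])
      (auto simp: space_pair_measure space_sphere_measure space_coupling
        intro!: gb abs_inner_unit_sphere_le)
  have "(\<integral>z. norm (H z) \<partial>sphere_measure) \<le> (\<integral>z. c + (\<integral>p. g (z \<bullet> snd p) \<partial>\<gamma>) \<partial>sphere_measure)"
    using Hint P.integrable_fst[OF gint] pointwise
    by (intro Bochner_Integration.integral_mono) (auto simp: space_sphere_measure)
  also have "\<dots> = c + (\<integral>z. (\<integral>p. g (z \<bullet> snd p) \<partial>\<gamma>) \<partial>sphere_measure)"
    using P.integrable_fst[OF gint]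
    by (subst Bochner_Integration.integral_add) (auto simp: \<mu>.prob_space)
  also have "(\<integral>z. (\<integral>p. g (z \<bullet> snd p) \<partial>\<gamma>) \<partial>sphere_measure) =
      (\<integral>p. (\<integral>z. g (z \<bullet> snd p) \<partial>sphere_measure) \<partial>\<gamma>)"
    by (rule P.Fubini_integral[OF gint, symmetric])
  \<comment> \<open>After the exchange the inner integral is zonal about the unit vector
    \<open>snd p\<close>, so it has the same value for every p, whatever the law of
    \<open>snd p\<close>.\<close>
  also have "\<dots> = (\<integral>p. (\<integral>\<omega>. g (e \<bullet> \<omega>) \<partial>sphere_measure) \<partial>\<gamma>)"
  proof (rule Bochner_Integration.integral_cong[OF refl])
    fix p assume "p \<in> space \<gamma>"
    then have "norm (snd p) = norm e" using e by (auto simp: space_coupling)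
    from integral_zonal_eq[OF this g]
    show "(\<integral>z. g (z \<bullet> snd p) \<partial>sphere_measure) = (\<integral>\<omega>. g (e \<bullet> \<omega>) \<partial>sphere_measure)"
      by (simp add: inner_commute)
  qed
  also have "\<dots> = (\<integral>\<omega>. K (e \<bullet> \<omega>) * (e \<bullet> \<omega>) - \<Phi> (e \<bullet> \<omega>) \<partial>sphere_measure)"
    by (simp add: \<gamma>.prob_space g_def)
  \<comment> \<open>The \<open>- c\<close> produced here cancels the \<open>c\<close> coming from
    \<open>pointwise\<close>.\<close>
  also have "\<dots> = (\<integral>\<omega>. K (e \<bullet> \<omega>) * (e \<bullet> \<omega>) \<partial>sphere_measure) - c"
    unfolding c_def
  proof (rule Bochner_Integration.integral_diff)
    show "integrable sphere_measure (\<lambda>\<omega>. K (e \<bullet> \<omega>) * (e \<bullet> \<omega>))"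
      unfolding inner_scaleR_right[symmetric]
      by (rule integrable_inner_right, rule sb[where B = B]) (use absK in auto)
    show "integrable sphere_measure (\<lambda>\<omega>. \<Phi> (e \<bullet> \<omega>))"
      by (rule sb[where B = "\<Phi> 1"]) (auto intro!: \<Phi>b abs_inner_unit_sphere_le e)
  qed
  finally show "(\<integral>z. norm (H z) \<partial>sphere_measure) \<le>
      (\<integral>\<omega>. K (e \<bullet> \<omega>) * (e \<bullet> \<omega>) \<partial>sphere_measure)"
    by simp
qed

end

section \<open>Equality on the diagonal\<close>

text \<open>With \<omega> = x and the unit field F z = z, the two arguments t and u of Young's
  inequality coincide, so the estimate loses nothing.\<close>

definition diagonal_coupling :: "((real ^ 'n) \<times> (real ^ 'n)) measure"
  where "diagonal_coupling =
    distr sphere_measure (restrict_space borel (unit_sphere \<times> unit_sphere)) (\<lambda>x. (x, x))"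

lemma measurable_diagonal:
  "(\<lambda>x. (x, x)) \<in> (sphere_measure :: (real ^ 'n) measure) \<rightarrow>\<^sub>M
    restrict_space borel (unit_sphere \<times> unit_sphere)"
  by (intro measurable_restrict_space2 measurable_sphere_measureI borel_measurable_continuous_onI
      continuous_intros) (auto simp: space_sphere_measure)

lemma sphere_coupling_diagonal:
  "sphere_coupling (diagonal_coupling :: ((real ^ 'n) \<times> (real ^ 'n)) measure)"
proof -
  interpret prob_space "sphere_measure :: (real ^ 'n) measure" by (rule prob_space_sphere_measure)
  have "(fst :: (real ^ 'n) \<times> (real ^ 'n) \<Rightarrow> _) \<in> restrict_space borel (unit_sphere \<times> unit_sphere)
      \<rightarrow>\<^sub>M restrict_space borel unit_sphere"
    by (intro measurable_restrict_space3 borel_measurable_continuous_onI continuous_intros) auto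
  then have "distr (diagonal_coupling :: ((real ^ 'n) \<times> (real ^ 'n)) measure)
      (restrict_space borel unit_sphere) fst = sphere_measure"
    unfolding diagonal_coupling_def
    by (subst distr_distr[OF _ measurable_diagonal])
      (auto simp: o_def intro!: distr_id2 sets_sphere_measure[symmetric])
  then show ?thesis
    unfolding sphere_coupling_def diagonal_coupling_def
    using prob_space_distr[OF measurable_diagonal] by simp
qed

section \<open>Transfer from the extended kernel to \<open>K\<close>, and sharpness\<close>

theorem proposition3p3:
  fixes K :: "real \<Rightarrow> real"
  assumes "CARD('n::finite) \<ge> 3"
    and "\<And>t. t \<in> {-1..1} \<Longrightarrow> K t \<ge> 0"
    and "bounded (K ` {-1..1})"
    and "K \<in> borel_measurable (restrict_space borel {-1..1})"
    and "mono_on {-1..1} K"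
  shows
    "(\<forall>z\<in>(unit_sphere :: (real ^ 'n) set).
        (\<integral>\<omega>. K (z \<bullet> \<omega>) *\<^sub>R \<omega> \<partial>sphere_measure) = degree_one_multiplier TYPE('n) K *\<^sub>R z) \<and>
     (\<forall>\<gamma> :: ((real ^ 'n) \<times> (real ^ 'n)) measure. sphere_coupling \<gamma> \<longrightarrow>
        (\<forall>z\<in>unit_sphere. sphere_op_vector K (coupling_vector_measure \<gamma>) z =
          (\<integral>(x, \<omega>). K (z \<bullet> \<omega>) *\<^sub>R x \<partial>\<gamma>)) \<and>
        integrable sphere_measure (sphere_op_vector K (coupling_vector_measure \<gamma>)) \<and>
        (\<integral>z. norm (sphere_op_vector K (coupling_vector_measure \<gamma>) z) \<partial>sphere_measure)
          \<le> degree_one_multiplier TYPE('n) K) \<and>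
     (\<exists>\<gamma> :: ((real ^ 'n) \<times> (real ^ 'n)) measure. sphere_coupling \<gamma> \<and>
        (\<integral>z. norm (sphere_op_vector K (coupling_vector_measure \<gamma>) z) \<partial>sphere_measure)
          = degree_one_multiplier TYPE('n) K)"
proof -
  \<comment> \<open>Extend \<open>K\<close> to a monotone, hence Borel, function on the line.\<close>
  define L where "L = (\<lambda>t. K (max (- 1) (min 1 t)))"
  have L_eq: "K t = L t" if "\<bar>t\<bar> \<le> 1" for t
    using that by (simp add: L_def)
  have KL: "K (z \<bullet> \<omega>) = L (z \<bullet> \<omega>)" if "norm z = 1" "norm \<omega> = 1" for z \<omega> :: "real ^ 'n"
    by (rule L_eq[OF abs_inner_unit_sphere_le[OF that]])
  have monoL: "mono L"
    using assms(5) by (auto simp: L_def mono_on_def intro!: monoI)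
  have nonneg: "0 \<le> L t" for t using assms(2) by (simp add: L_def)
  obtain B where "\<And>t. t \<in> {-1..1} \<Longrightarrow> \<bar>K t\<bar> \<le> B"
    using assms(3) unfolding bounded_real by blast
  then have absL: "\<bar>L t\<bar> \<le> B" for t by (simp add: L_def)
  then have bdL: "L t \<le> B" for t using abs_le_D1 by blast
  have Lm[measurable]: "L \<in> borel_measurable borel" by (rule borel_measurable_mono[OF monoL])
  \<comment> \<open>The index \<open>undefined\<close> is an arbitrary one; any unit vector can
    serve as the pole.\<close>
  define e :: "real ^ 'n" where "e = axis undefined 1"
  have e: "norm e = 1" by (simp add: e_def)
  define \<kappa> where "\<kappa> = degree_one_multiplier TYPE('n) K"
  have \<kappa>: "\<kappa> = (\<integral>\<omega>. L (z \<bullet> \<omega>) * (z \<bullet> \<omega>) \<partial>sphere_measure)" if "norm z = 1" for z :: "real ^ 'n"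
  proof -
    \<comment> \<open>Inner products of unit vectors lie in [-1,1], where \<open>K\<close> and
      \<open>L\<close> agree, so both kernels satisfy the same condition under the
      \<open>THE\<close> defining the multiplier.\<close>
    have "sphere_op K Y w = sphere_op L Y w" if "w \<in> unit_sphere" for Y and w :: "real ^ 'n"
      unfolding sphere_op_def using that
      by (intro Bochner_Integration.integral_cong) (auto simp: KL space_sphere_measure)
    then have "\<kappa> = degree_one_multiplier TYPE('n) L"
      unfolding \<kappa>_def degree_one_multiplier_def by simp
    then show ?thesis by (simp add: degree_one_multiplier_eq[OF that Lm absL])
  qed
  have ident: "(\<integral>\<omega>. L (z \<bullet> \<omega>) *\<^sub>R \<omega> \<partial>sphere_measure) = \<kappa> *\<^sub>R z" if "norm z = 1" for z :: "real ^ 'n"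
    by (simp add: \<kappa>[OF that] integral_zonal_times_ident[OF that Lm absL])
  have op: "sphere_op_vector K (coupling_vector_measure \<gamma>) z = (\<integral>p. L (z \<bullet> snd p) *\<^sub>R fst p \<partial>\<gamma>)"
    if \<gamma>: "sphere_coupling \<gamma>" and z: "norm z = 1"
    for z :: "real ^ 'n" and \<gamma> :: "((real ^ 'n) \<times> (real ^ 'n)) measure"
  proof -
    \<comment> \<open>The integrand enters the definition of \<open>vector_measure_integral\<close>
      only through uniform convergence on the sphere, so agreement there is enough to exchange
      \<open>K\<close> and \<open>L\<close>.\<close>
    have "uniform_limit unit_sphere s (\<lambda>\<omega>. K (z \<bullet> \<omega>)) sequentially \<longleftrightarrow>
        uniform_limit unit_sphere s (\<lambda>\<omega>. L (z \<bullet> \<omega>)) sequentially" for s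
      by (rule uniform_limit_cong') (auto simp: KL[OF z])
    then have "sphere_op_vector K (coupling_vector_measure \<gamma>) z =
        sphere_op_vector L (coupling_vector_measure \<gamma>) z"
      by (simp add: sphere_op_vector_def vector_measure_integral_def space_restrict_space)
    then show ?thesis by (simp add: sphere_op_vector_coupling[OF \<gamma> Lm absL])
  qed
  have bound: "integrable sphere_measure (sphere_op_vector K (coupling_vector_measure \<gamma>)) \<and>
      (\<integral>z. norm (sphere_op_vector K (coupling_vector_measure \<gamma>) z) \<partial>sphere_measure) \<le> \<kappa>"
    if \<gamma>: "sphere_coupling \<gamma>" for \<gamma> :: "((real ^ 'n) \<times> (real ^ 'n)) measure"
  proof -
    let ?H = "\<lambda>z :: real ^ 'n. \<integral>p. L (z \<bullet> snd p) *\<^sub>R fst p \<partial>\<gamma>"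
    have "integrable sphere_measure (sphere_op_vector K (coupling_vector_measure \<gamma>)) \<longleftrightarrow>
        integrable sphere_measure ?H"
      by (rule Bochner_Integration.integrable_cong) (auto simp: op[OF \<gamma>] space_sphere_measure)
    moreover have "(\<integral>z. norm (sphere_op_vector K (coupling_vector_measure \<gamma>) z) \<partial>sphere_measure) =
        (\<integral>z. norm (?H z) \<partial>sphere_measure)"
      by (rule Bochner_Integration.integral_cong) (auto simp: op[OF \<gamma>] space_sphere_measure)
    ultimately show ?thesis
      using integrable_coupling_kernel[OF \<gamma> monoL nonneg bdL e]
        integral_norm_coupling_kernel_le[OF \<gamma> monoL nonneg bdL e] \<kappa>[OF e] by simp
  qed
  \<comment> \<open>The norm of \<open>\<kappa> *\<^sub>R z\<close> gives the absolute value; the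
    sign of \<kappa> is not known at this stage.\<close>
  have diag: "(\<integral>z. norm (sphere_op_vector K (coupling_vector_measure diagonal_coupling) (z :: real ^ 'n))
      \<partial>sphere_measure) = \<bar>\<kappa>\<bar>"
  proof -
    interpret prob_space "sphere_measure :: (real ^ 'n) measure" by (rule prob_space_sphere_measure)
    have "sphere_op_vector K (coupling_vector_measure diagonal_coupling) z = \<kappa> *\<^sub>R z"
      if z: "norm z = 1" for z :: "real ^ 'n"
    proof -
      have "(\<lambda>p. L (z \<bullet> snd p) *\<^sub>R fst p) \<in> borel_measurable (restrict_space borel (unit_sphere \<times> unit_sphere))"
        by (intro measurable_restrict_space1) (simp add: borel_prod[symmetric])
      from integral_distr[OF measurable_diagonal this] show ?thesis
        by (simp add: op[OF sphere_coupling_diagonal z] diagonal_coupling_def[symmetric] ident[OF z])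
    qed
    then have "(\<integral>z. norm (sphere_op_vector K (coupling_vector_measure diagonal_coupling) (z :: real ^ 'n))
        \<partial>sphere_measure) = (\<integral>z. \<bar>\<kappa>\<bar> \<partial>(sphere_measure :: (real ^ 'n) measure))"
      by (intro Bochner_Integration.integral_cong) (auto simp: space_sphere_measure)
    then show ?thesis by (simp add: prob_space)
  qed
  \<comment> \<open>For the diagonal coupling the upper bound reads
    \<open>\<bar>\<kappa>\<bar> \<le> \<kappa>\<close>.\<close>
  moreover have "\<kappa> \<ge> 0"
    using bound[OF sphere_coupling_diagonal] diag by linarith
  moreover have "(\<integral>\<omega>. K (z \<bullet> \<omega>) *\<^sub>R \<omega> \<partial>sphere_measure) = \<kappa> *\<^sub>R z"
    if z: "norm z = 1" for z :: "real ^ 'n"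
    unfolding ident[OF z, symmetric]
    by (rule Bochner_Integration.integral_cong) (auto simp: KL[OF z] space_sphere_measure)
  moreover have "sphere_op_vector K (coupling_vector_measure \<gamma>) z = (\<integral>(x, \<omega>). K (z \<bullet> \<omega>) *\<^sub>R x \<partial>\<gamma>)"
    if \<gamma>: "sphere_coupling \<gamma>" and z: "norm z = 1"
    for z :: "real ^ 'n" and \<gamma> :: "((real ^ 'n) \<times> (real ^ 'n)) measure"
    unfolding op[OF that]
    by (rule Bochner_Integration.integral_cong) (auto simp: KL[OF z] space_coupling[OF \<gamma>])
  ultimately show ?thesis
    unfolding \<kappa>_def[symmetric] using bound sphere_coupling_diagonal
    by (intro conjI exI[of _ diagonal_coupling]) auto
qed

end
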